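(* Let $P \subseteq \mathbb{R}^n$ be nonempty, let $V$ be the affine hull of $P$, let $\pi \in \mathbb{Z}^n$ and $\pi_0 \in \mathbb{Z}$, and assume $\operatorname{proj}_V \pi \neq 0$. Then \[ \operatorname{depth}_P\left(P^{(\pi,\pi_0)}\right) \le \frac{1}{\|\operatorname{proj}_V \pi\|}. \] Furthermore, if $P$ is full-dimensional, then $\operatorname{depth}_P\left(P^{(\pi,\pi_0)}\right) \le \frac{1}{\|\pi\|}$. Moreover, for every $x \in P \setminus P^{(\pi,\pi_0)}$, \[ \operatorname{depth}_P(x) \le \frac{\max\{\pi^T x - \lfloor \pi^T x \rfloor,\ \lceil \pi^T x \rceil - \pi^T x\}}{\|\operatorname{proj}_V \pi\|}, \] and if $P$ is full-dimensional, then \[ \operatorname{depth}_P(x) \le \frac{\max\{\pi^T x - \lfloor \pi^T x \rfloor,\ \lceil \pi^T x \rceil - \pi^T x\}}{\|\pi\|}. \]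
   Context: $\|\cdot\|$ is the Euclidean norm on $\mathbb{R}^n$, and $B(x,r) := \{y \in \mathbb{R}^n : \|y-x\| \le r\}$ for $r \in \mathbb{R}_+$. For $P \subseteq \mathbb{R}^n$ and $x \in P$, $\operatorname{depth}_P(x) := \sup\{ r \in \mathbb{R}_+ : B(x,r) \cap \operatorname{aff}(P) \subseteq P\}$, where $\operatorname{aff}(P)$ is the affine hull of $P$. For a set $S$ (normally $S \subseteq P$; the same formula is used for $S = P^{(\pi,\pi_0)}$ even if $P$ is not convex), $\operatorname{depth}_P(S) := \sup\{\operatorname{depth}_P(x) : x \in P \setminus S\}$. Suprema are taken in $[0,+\infty]$, so the supremum of the empty set is $0$. For $\pi \in \mathbb{Z}^n$, $\pi_0 \in \mathbb{Z}$, $P^{(\pi,\pi_0)} := \operatorname{conv}\left(\{x \in P : \pi^T x \le \pi_0\} \cup \{x \in P : \pi^T x \ge \pi_0+1\}\right)$. For an affine subspace $V$ of $\mathbb{R}^n$, $\operatorname{proj}_V \pi$ denotes the orthogonal projection of the vector $\pi$ onto the linear direction space $\{u - w : u, w \in V\}$ of $V$. "Full-dimensional" means $\operatorname{aff}(P) = \mathbb{R}^n$. *)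

theory Defs
  imports "HOL-Analysis.Analysis"
begin

(* Depths live in [0,\<infinity>], rendered as ennreal, where Sup {} = 0. *)

definition point_depth :: "(real ^ 'n) set \<Rightarrow> real ^ 'n \<Rightarrow> ennreal" where
  "point_depth P x = Sup {ennreal r | r. 0 \<le> r \<and> cball x r \<inter> affine hull P \<subseteq> P}"

definition set_depth :: "(real ^ 'n) set \<Rightarrow> (real ^ 'n) set \<Rightarrow> ennreal" where
  "set_depth P S = (SUP x \<in> P - S. point_depth P x)"

definition split_set :: "(real ^ 'n) set \<Rightarrow> real ^ 'n \<Rightarrow> int \<Rightarrow> (real ^ 'n) set" where
  "split_set P a b =
     convex hull ({x \<in> P. a \<bullet> x \<le> of_int b} \<union> {x \<in> P. a \<bullet> x \<ge> of_int b + 1})"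

definition direction_space :: "(real ^ 'n) set \<Rightarrow> (real ^ 'n) set" where
  "direction_space V = {u - w | u w. u \<in> V \<and> w \<in> V}"

(* Note that this projects onto the linear direction space of V, not onto V itself. *)

definition dir_proj :: "(real ^ 'n) set \<Rightarrow> real ^ 'n \<Rightarrow> real ^ 'n" where
  "dir_proj V v =
     (THE p. p \<in> direction_space V \<and> (\<forall>d \<in> direction_space V. orthogonal (v - p) d))"

lemma subspace_direction_space:
  assumes "affine V" "V \<noteq> {}"
  shows "subspace (direction_space V)"
proof -
  obtain a where a: "a \<in> V" using assms(2) by blast
  have "direction_space V = (\<lambda>x. x - a) ` V"
  proof
    show "direction_space V \<subseteq> (\<lambda>x. x - a) ` V"
    proof
      fix z assume "z \<in> direction_space V"
      then obtain u w where uw: "u \<in> V" "w \<in> V" "z = u - w"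
        by (auto simp: direction_space_def)
      have "a + 1 *\<^sub>R (u - w) \<in> V"
        by (rule mem_affine_3_minus[OF assms(1) a uw(1,2)])
      with uw show "z \<in> (\<lambda>x. x - a) ` V"
        by (intro image_eqI[of _ _ "a + (u - w)"]) auto
    qed
    show "(\<lambda>x. x - a) ` V \<subseteq> direction_space V"
      using a by (auto simp: direction_space_def)
  qed
  then show ?thesis
    using affine_diffs_subspace_subtract[OF assms(1) a] by simp
qed

lemma dir_proj_ex1:
  assumes "affine V" "V \<noteq> {}"
  shows "\<exists>!p. p \<in> direction_space V \<and> (\<forall>d \<in> direction_space V. orthogonal (v - p) d)"
proof (rule ex_ex1I)
  let ?L = "direction_space V"
  have L: "subspace ?L" by (rule subspace_direction_space[OF assms])
  have sL: "span ?L = ?L" using L by (simp only: span_eq_iff)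
  obtain y z where "y \<in> ?L" "\<And>w. w \<in> ?L \<Longrightarrow> orthogonal z w" "v = y + z"
    using orthogonal_subspace_decomp_exists[of ?L v] unfolding sL by metis
  then show "\<exists>p. p \<in> ?L \<and> (\<forall>d \<in> ?L. orthogonal (v - p) d)"
    by (intro exI[of _ y]) auto
  fix p q
  assume p: "p \<in> ?L \<and> (\<forall>d \<in> ?L. orthogonal (v - p) d)"
    and q: "q \<in> ?L \<and> (\<forall>d \<in> ?L. orthogonal (v - q) d)"
  have "p - q \<in> ?L" using p q L by (simp add: subspace_diff)
  then have "(v - q) \<bullet> (p - q) = 0" "(v - p) \<bullet> (p - q) = 0"
    using p q by (auto simp: orthogonal_def)
  then have "(p - q) \<bullet> (p - q) = 0" by (simp add: inner_diff_left)
  then show "p = q" by simp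
qed

end

theory Submission
  imports Defs
begin

text \<open>A point \<open>x\<close> of \<open>P\<close> outside the split set lies strictly between the two hyperplanes of the
  split. If a ball around \<open>x\<close>, intersected with the affine hull, stayed inside \<open>P\<close> and reached both
  hyperplanes along the projection \<open>p\<close> of the normal, then \<open>x\<close> would be the midpoint of the two
  points of \<open>P\<close> reached along \<open>p\<close> and \<open>- p\<close>, and so belong to the split set after all.\<close>

lemma
  assumes "affine V" "V \<noteq> {}"
  shows dir_proj_in_direction_space: "dir_proj V v \<in> direction_space V"
    and orthogonal_dir_proj: "d \<in> direction_space V \<Longrightarrow> orthogonal (v - dir_proj V v) d"
  using theI'[OF dir_proj_ex1[OF assms, of v]] unfolding dir_proj_def by auto

text \<open>The residual \<open>v - dir_proj V v\<close> is orthogonal to the projection itself.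
  Hence moving along the projection changes the functional \<open>v\<close> at a positive rate
  whenever the projection is nonzero.\<close>

lemma inner_dir_proj:
  assumes "affine V" "V \<noteq> {}"
  shows "v \<bullet> dir_proj V v = (norm (dir_proj V v))\<^sup>2"
  using orthogonal_dir_proj[OF assms dir_proj_in_direction_space[OF assms], of v v]
  by (simp add: orthogonal_def inner_diff_left power2_norm_eq_inner)

text \<open>Every vector is a direction of the whole space, so the residual is orthogonal to itself.
  This yields the full-dimensional bounds.\<close>

lemma dir_proj_UNIV [simp]: "dir_proj UNIV v = v"
proof -
  have "v - dir_proj UNIV v \<in> direction_space UNIV"
    by (auto simp: direction_space_def)
  then have "orthogonal (v - dir_proj UNIV v) (v - dir_proj UNIV v)"
    by (intro orthogonal_dir_proj) auto
  then show ?thesis by (simp add: orthogonal_self)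
qed

lemma add_scaleR_direction_space:
  assumes "affine V" "x \<in> V" "d \<in> direction_space V"
  shows "x + t *\<^sub>R d \<in> V"
  using assms mem_affine_3_minus by (auto simp: direction_space_def)

text \<open>If either inequality failed, \<open>x\<close> would be one of the points whose hull is
  the split set.\<close>

lemma not_in_split_set_bounds:
  assumes "x \<in> P - split_set P a b"
  shows "of_int b < a \<bullet> x" "a \<bullet> x < of_int b + 1"
  using assms hull_inc[of x "{x \<in> P. a \<bullet> x \<le> of_int b} \<union> {x \<in> P. a \<bullet> x \<ge> of_int b + 1}" convex]
  by (force simp: split_set_def not_le)+

lemma point_depth_outside_split_set:
  fixes P :: "(real ^ 'n) set"
  assumes x: "x \<in> P - split_set P a b" and p0: "dir_proj (affine hull P) a \<noteq> 0"
  shows "point_depth P x \<le>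
    ennreal (max (a \<bullet> x - of_int b) (of_int b + 1 - a \<bullet> x) / norm (dir_proj (affine hull P) a))"
proof -
  define V where "V = affine hull P"
  define p where "p = dir_proj V a"
  define M where "M = max (a \<bullet> x - of_int b) (of_int b + 1 - a \<bullet> x)"
  have xV: "x \<in> V" using x by (simp add: V_def hull_inc)
  have V: "affine V" "V \<noteq> {}" using xV by (auto simp: V_def)
  have p: "p \<in> direction_space V" "a \<bullet> p = (norm p)\<^sup>2" "norm p > 0"
    using dir_proj_in_direction_space[OF V] inner_dir_proj[OF V] p0 by (auto simp: p_def V_def)
  have "r \<le> M / norm p" if r: "0 \<le> r" "cball x r \<inter> V \<subseteq> P" for r
  proof (rule ccontr)
    assume "\<not> r \<le> M / norm p"
    \<comment> \<open>\<open>M\<close> is the gap in \<open>a\<close>-value to the farther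
      hyperplane; a step of length \<open>r\<close> along \<open>p\<close> changes that value by
      \<open>r * norm p\<close>, so it clears either gap.\<close>
    then have M: "M < r * norm p" using p(3) by (simp add: field_simps)
    \<comment> \<open>With this factor \<open>t *\<^sub>R p\<close> has length \<open>r\<close>, so
      both endpoints lie on the boundary of the ball.\<close>
    define t where "t = r / norm p"
    have in_P: "x + s *\<^sub>R p \<in> P" if "\<bar>s\<bar> = t" for s
      using r(2) add_scaleR_direction_space[OF V(1) xV p(1), of s] that p(3)
      by (auto simp: subset_iff dist_norm t_def)
    have a: "a \<bullet> (x + s *\<^sub>R p) = a \<bullet> x + s * (norm p)\<^sup>2" for s
      by (simp add: inner_add_right p(2))
    have tp: "t * (norm p)\<^sup>2 = r * norm p"
      using p(3) by (simp add: t_def power2_eq_square)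
    have t: "0 \<le> t" using r(1) p(3) by (simp add: t_def)
    have up: "x + t *\<^sub>R p \<in> split_set P a b"
      unfolding split_set_def
      using in_P[of t] a[of t] tp t M by (intro hull_inc) (auto simp: M_def)
    have dn: "x + (- t) *\<^sub>R p \<in> split_set P a b"
      unfolding split_set_def
      using in_P[of "- t"] a[of "- t"] tp t M by (intro hull_inc) (auto simp: M_def)
    have "convex (split_set P a b)" by (simp add: split_set_def)
    then have "(1/2) *\<^sub>R (x + t *\<^sub>R p) + (1/2) *\<^sub>R (x + (- t) *\<^sub>R p) \<in> split_set P a b"
      using up dn by (intro convexD) auto
    moreover have "(1/2) *\<^sub>R (x + t *\<^sub>R p) + (1/2) *\<^sub>R (x + (- t) *\<^sub>R p) = x"
      by (simp add: algebra_simps flip: scaleR_left_distrib)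
    ultimately show False using x by simp
  qed
  then show ?thesis
    unfolding point_depth_def V_def[symmetric] p_def[symmetric] M_def[symmetric]
    by (intro Sup_least) (auto intro: ennreal_leI)
qed

lemma set_depth_split_set:
  fixes P :: "(real ^ 'n) set"
  assumes "dir_proj (affine hull P) a \<noteq> 0"
  shows "set_depth P (split_set P a b) \<le> ennreal (1 / norm (dir_proj (affine hull P) a))"
  unfolding set_depth_def
proof (rule SUP_least)
  fix x assume x: "x \<in> P - split_set P a b"
  \<comment> \<open>The two gaps are positive and sum to 1.\<close>
  have "max (a \<bullet> x - of_int b) (of_int b + 1 - a \<bullet> x) \<le> 1"
    using not_in_split_set_bounds[OF x] by simp
  then show "point_depth P x \<le> ennreal (1 / norm (dir_proj (affine hull P) a))"
    by (intro order_trans[OF point_depth_outside_split_set[OF x assms]] ennreal_leI divide_right_mono)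
      auto
qed

theorem corollary3:
  fixes P V :: "(real ^ 'n) set" and \<pi> :: "real ^ 'n" and \<pi>\<^sub>0 :: int
  assumes "P \<noteq> {}"
    and "V = affine hull P"
    and "\<forall>i. \<pi> $ i \<in> \<int>"
    and "dir_proj V \<pi> \<noteq> 0"
  shows "set_depth P (split_set P \<pi> \<pi>\<^sub>0) \<le> ennreal (1 / norm (dir_proj V \<pi>)) \<and>
    (affine hull P = UNIV \<longrightarrow>
      set_depth P (split_set P \<pi> \<pi>\<^sub>0) \<le> ennreal (1 / norm \<pi>)) \<and>
    (\<forall>x \<in> P - split_set P \<pi> \<pi>\<^sub>0.
      point_depth P x \<le>
        ennreal (max (\<pi> \<bullet> x - of_int \<lfloor>\<pi> \<bullet> x\<rfloor>) (of_int \<lceil>\<pi> \<bullet> x\<rceil> - \<pi> \<bullet> x) / norm (dir_proj V \<pi>))) \<and>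
    (affine hull P = UNIV \<longrightarrow>
      (\<forall>x \<in> P - split_set P \<pi> \<pi>\<^sub>0.
        point_depth P x \<le>
          ennreal (max (\<pi> \<bullet> x - of_int \<lfloor>\<pi> \<bullet> x\<rfloor>) (of_int \<lceil>\<pi> \<bullet> x\<rceil> - \<pi> \<bullet> x) / norm \<pi>)))"
proof -
  have depth: "point_depth P x \<le>
      ennreal (max (\<pi> \<bullet> x - of_int \<lfloor>\<pi> \<bullet> x\<rfloor>) (of_int \<lceil>\<pi> \<bullet> x\<rceil> - \<pi> \<bullet> x) / norm (dir_proj V \<pi>))"
    if x: "x \<in> P - split_set P \<pi> \<pi>\<^sub>0" for x
  proof -
    \<comment> \<open>Both bounds are strict, so the value lies in the open interval between
      consecutive integers; at an endpoint floor and ceiling would coincide.\<close>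
    have "\<lfloor>\<pi> \<bullet> x\<rfloor> = \<pi>\<^sub>0" "\<lceil>\<pi> \<bullet> x\<rceil> = \<pi>\<^sub>0 + 1"
      using not_in_split_set_bounds[OF x] by linarith+
    then show ?thesis
      using point_depth_outside_split_set[OF x] assms by simp
  qed
  have set_depth: "set_depth P (split_set P \<pi> \<pi>\<^sub>0) \<le> ennreal (1 / norm (dir_proj V \<pi>))"
    using set_depth_split_set assms by blast
  have "dir_proj V \<pi> = \<pi>" if "affine hull P = UNIV"
    using that assms by simp
  with depth set_depth show ?thesis by auto
qed

end
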